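(* Let $U_2,U_3,\dots$ be independent random variables with $U_m\sim\mathrm{Bern}\big(\frac1{2m}\big)$, $m\ge2$. Then, for $n\ge1$ and $d\ge0$, $$p_{\mathrm{walk}}(n,d)=\mathbb{P}\Big(\sum_{m=2}^nU_m\ge d\Big).$$ Consequently, for $n\ge2$ and $d\ge1$, $$p_{\mathrm{walk}}(n,d)=\frac{2n-1}{2n}\,p_{\mathrm{walk}}(n-1,d)+\frac1{2n}\,p_{\mathrm{walk}}(n-1,d-1).$$ Together with the boundary conditions $p_{\mathrm{walk}}(n,0)=1$ for all $n\ge1$ and $p_{\mathrm{walk}}(1,d)=0$ for all $d\ge1$, this recurrence uniquely determines the array $(p_{\mathrm{walk}}(n,d))_{n\ge1,d\ge0}$.
   Context: The array is defined by $$p_{\mathrm{walk}}(n,d):=\frac{2}{2^nn!}\sum_{r\ge0}B(n,d+1+2r),\qquad n\ge1,\ d\ge0,$$ where $B(n,k)$, $k\in\mathbb{Z}$, is defined by $(t+1)(t+3)\cdots(t+2n-1)=\sum_{k\in\mathbb{Z}}B(n,k)t^k$ (so $B(n,k)=0$ for $k\notin\{0,\dots,n\}$). An empty sum is zero. $\mathrm{Bern}(p)$ is the Bernoulli distribution on $\{0,1\}$ with success probability $p$. *)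

theory Defs
  imports "HOL-Probability.Probability" "HOL-Computational_Algebra.Polynomial"
begin

(* Coefficient of t^k in (t+1)(t+3)...(t+2n-1), extended by 0 to negative k. *)
definition B :: "nat \<Rightarrow> int \<Rightarrow> int" where
  "B n k = (if k < 0 then 0 else coeff (\<Prod>i=1..n. [:2 * int i - 1, 1:]) (nat k))"

(* The series has only finitely many nonzero terms, since B n k = 0 for k > n. *)
definition p_walk :: "nat \<Rightarrow> nat \<Rightarrow> real" where
  "p_walk n d = 2 / (2 ^ n * fact n) * (\<Sum>r. real_of_int (B n (int d + 1 + 2 * int r)))"

(* bernoulli_pmf lives on bool; this is its image on {0,1}. *)
definition Bern :: "real \<Rightarrow> nat pmf" where
  "Bern p = map_pmf of_bool (bernoulli_pmf p)"

end

theory Submission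
  imports Defs
begin

text \<open>Multiplying by the factor $t + 2n - 1$ gives a recurrence for the coefficients, which passes to
  their sums in steps of two and, after normalisation, becomes the recurrence for the array.
  Conditioning on $U_n$ gives the same recurrence for the tail probabilities, and the recurrence
  with its boundary values has only one solution.\<close>

section \<open>Coefficients of the product and their sums in steps of two\<close>

definition step_coeff :: "nat \<Rightarrow> nat \<Rightarrow> int" where
  "step_coeff n k = coeff (\<Prod>i=1..n. [:2 * int i - 1, 1:]) k"

lemma step_coeff_0: "step_coeff 0 k = (if k = 0 then 1 else 0)"
  by (simp add: step_coeff_def)

lemma step_coeff_Suc_0: "step_coeff (Suc n) 0 = (2 * int n + 1) * step_coeff n 0"
  by (simp add: step_coeff_def coeff_mult_0 algebra_simps)

lemma step_coeff_Suc_Suc: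
  "step_coeff (Suc n) (Suc k) = (2 * int n + 1) * step_coeff n (Suc k) + step_coeff n k"
  by (simp add: step_coeff_def algebra_simps)

lemma step_coeff_eq_0: "n < k \<Longrightarrow> step_coeff n k = 0"
proof (induction n arbitrary: k)
  case (Suc n)
  then show ?case by (cases k) (auto simp: step_coeff_Suc_Suc)
qed (simp add: step_coeff_0)

definition alternate_sum :: "nat \<Rightarrow> nat \<Rightarrow> real" where
  "alternate_sum n k = (\<Sum>r. real_of_int (step_coeff n (k + 2 * r)))"

lemma p_walk_eq_alternate_sum: "p_walk n d = 2 / (2 ^ n * fact n) * alternate_sum n (Suc d)"
proof -
  have "B n (int d + 1 + 2 * int r) = step_coeff n (Suc d + 2 * r)" for r
  proof -
    have "nat (int d + 1 + 2 * int r) = Suc d + 2 * r" by simp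
    then show ?thesis unfolding B_def step_coeff_def by simp
  qed
  then show ?thesis by (simp add: p_walk_def alternate_sum_def)
qed

lemma summable_step_coeff: "summable (\<lambda>r. real_of_int (step_coeff n (k + 2 * r)))"
  by (rule summable_finite[of "{..n}"]) (auto simp: step_coeff_eq_0)

lemma alternate_sum_split: "alternate_sum n k = step_coeff n k + alternate_sum n (k + 2)"
  using suminf_split_head[OF summable_step_coeff[of n k]]
  by (simp add: alternate_sum_def)

lemma alternate_sum_0: "alternate_sum 0 k = (if k = 0 then 1 else 0)"
proof -
  have "alternate_sum 0 (Suc k) = 0" for k
    by (simp add: alternate_sum_def step_coeff_0)
  then show ?thesis
    using alternate_sum_split[of 0 k] by (cases k) (auto simp: step_coeff_0)
qed

lemma alternate_sum_Suc_Suc: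
  "alternate_sum (Suc n) (Suc k) = (2 * real n + 1) * alternate_sum n (Suc k) + alternate_sum n k"
  unfolding alternate_sum_def
  \<comment> \<open>Summability is supplied in a second form because simp turns
    \<open>Suc k + 2 * r\<close> into \<open>Suc (k + 2 * r)\<close>.\<close>
  by (simp add: step_coeff_Suc_Suc suminf_add[symmetric] suminf_mult summable_mult
      summable_step_coeff summable_step_coeff[of n "Suc k", simplified])

text \<open>Formally the previous recurrence at index -1: the coefficient there is zero, so the sum
  starting at -1 equals the one starting at 1. The proof splits off the constant term and applies
  that recurrence to the rest, which starts at exponent 2.\<close>

lemma alternate_sum_Suc_0:
  "alternate_sum (Suc n) 0 = (2 * real n + 1) * alternate_sum n 0 + alternate_sum n 1"
  using alternate_sum_split[of "Suc n" 0] alternate_sum_split[of n 0]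
    alternate_sum_Suc_Suc[of n 1]
  by (simp add: step_coeff_Suc_0 algebra_simps numeral_2_eq_2)

text \<open>The sums over the even and over the odd exponents coincide because
  $t = -1$ is a root of $(t+1)(t+3)\cdots(t+2n-1)$.\<close>

lemma alternate_sum_parity:
  "alternate_sum (Suc n) 0 = 2 ^ n * fact (Suc n) \<and> alternate_sum (Suc n) 1 = 2 ^ n * fact (Suc n)"
proof (induction n)
  case 0
  show ?case
    using alternate_sum_Suc_0[of 0] alternate_sum_Suc_Suc[of 0 0] by (simp add: alternate_sum_0)
next
  case (Suc n)
  \<comment> \<open>If both sums equal c, both recurrences give (2n+3)c + c = 2(n+2)c, so the sums
    stay equal and acquire the next factor.\<close>
  then show ?case
    using alternate_sum_Suc_0[of "Suc n"] alternate_sum_Suc_Suc[of "Suc n" 0]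
    by (simp add: algebra_simps)
qed

section \<open>Boundary values, recurrence and uniqueness of the array\<close>

lemma p_walk_0: "1 \<le> n \<Longrightarrow> p_walk n 0 = 1"
  \<comment> \<open>The sum over odd exponents is half the value 2^n n! of the product at t = 1, and
    the numerator 2 in the normalisation makes up for the half.\<close>
  using alternate_sum_parity[of "n - 1"]
  by (cases n) (simp_all add: p_walk_eq_alternate_sum)

lemma p_walk_1: "1 \<le> d \<Longrightarrow> p_walk 1 d = 0"
  using alternate_sum_Suc_Suc[of 0 d]
  by (simp add: p_walk_eq_alternate_sum alternate_sum_0)

text \<open>The normalising denominator gains the factor 2n from row n - 1 to row n. Dividing the
  recurrence for \<open>alternate_sum\<close> by it leaves the weights 2n - 1 and 1 over 2n.\<close>

lemma p_walk_recurrence: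
  assumes "1 \<le> n" "1 \<le> d"
  shows "p_walk n d = (2 * real n - 1) / (2 * real n) * p_walk (n - 1) d
           + 1 / (2 * real n) * p_walk (n - 1) (d - 1)"
proof -
  obtain m e where "n = Suc m" "d = Suc e"
    using assms by (metis One_nat_def Suc_le_D)
  then show ?thesis
    by (simp add: p_walk_eq_alternate_sum alternate_sum_Suc_Suc[of m] divide_simps)
       (simp add: algebra_simps)
qed

text \<open>Row n follows from row n - 1, with column 0 prescribed. Stated for an arbitrary
  \<open>q\<close>, since it serves both the uniqueness claim and the identification of the tail
  probabilities with the array.\<close>

lemma p_walk_unique:
  fixes q :: "nat \<Rightarrow> nat \<Rightarrow> real"
  assumes rec: "\<And>n d. 2 \<le> n \<Longrightarrow> 1 \<le> d \<Longrightarrow>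
      q n d = (2 * real n - 1) / (2 * real n) * q (n - 1) d
              + 1 / (2 * real n) * q (n - 1) (d - 1)"
    and q_0: "\<And>n. 1 \<le> n \<Longrightarrow> q n 0 = 1"
    and q_1: "\<And>d. 1 \<le> d \<Longrightarrow> q 1 d = 0"
    and "1 \<le> n"
  shows "q n d = p_walk n d"
  using \<open>1 \<le> n\<close>
proof (induction n arbitrary: d rule: dec_induct)
  case base
  then show ?case
    using q_0[of 1] q_1[of d] p_walk_0[of 1] p_walk_1[of d] by (cases d) auto
next
  case (step n)
  show ?case
  proof (cases d)
    case 0
    then show ?thesis by (simp add: q_0 p_walk_0)
  next
    case (Suc e)
    then show ?thesis
      using rec[of "Suc n" d] p_walk_recurrence[of "Suc n" d] step by simp
  qed
qed

section \<open>Tail probabilities of sums of independent Bernoulli variables\<close>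

lemma measurable_sum_count_space:
  fixes f :: "'i \<Rightarrow> 'a \<Rightarrow> 'b::{countable, comm_monoid_add}"
  assumes "\<And>i. i \<in> I \<Longrightarrow> f i \<in> measurable M (count_space UNIV)"
  shows "(\<lambda>x. \<Sum>i\<in>I. f i x) \<in> measurable M (count_space UNIV)"
  using assms
proof (induction I rule: infinite_finite_induct)
  case (insert i I)
  have [measurable]: "f i \<in> measurable M (count_space UNIV)"
    "(\<lambda>x. \<Sum>i\<in>I. f i x) \<in> measurable M (count_space UNIV)"
    using insert by auto
  \<comment> \<open>Countability of \<open>'b\<close> enters here: an event about the sum is a
    countable union over the values of the two summands.\<close>
  have "(\<lambda>x. f i x + (\<Sum>i\<in>I. f i x)) \<in> measurable M (count_space UNIV)"
    by measurable
  then show ?case using insert by simp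
qed simp_all

context prob_space
begin

text \<open>The subfamilies over the disjoint index sets \<open>{i}\<close> and \<open>I\<close> are
  independent, and remain so under measurable maps, here a projection and a sum.\<close>

lemma indep_var_sum_count_space:
  fixes X :: "'i \<Rightarrow> 'a \<Rightarrow> 'b::{countable, comm_monoid_add}"
  assumes "i \<notin> I" "indep_vars (\<lambda>_. count_space UNIV) X (insert i I)"
  shows "indep_var (count_space UNIV) (X i) (count_space UNIV) (\<lambda>\<omega>. \<Sum>i\<in>I. X i \<omega>)"
proof -
  have "indep_var
    (count_space UNIV) ((\<lambda>f. f i) \<circ> (\<lambda>\<omega>. restrict (\<lambda>i. X i \<omega>) {i}))
    (count_space UNIV) ((\<lambda>f. \<Sum>i\<in>I. f i) \<circ> (\<lambda>\<omega>. restrict (\<lambda>i. X i \<omega>) I))"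
    using assms
    by (intro indep_var_compose[OF indep_var_restrict[OF assms(2)]]
        measurable_sum_count_space measurable_component_singleton) auto
  also have "(\<lambda>f. f i) \<circ> (\<lambda>\<omega>. restrict (\<lambda>i. X i \<omega>) {i}) = X i"
    by auto
  also have "(\<lambda>f. \<Sum>i\<in>I. f i) \<circ> (\<lambda>\<omega>. restrict (\<lambda>i. X i \<omega>) I) = (\<lambda>\<omega>. \<Sum>i\<in>I. X i \<omega>)"
    by (auto cong: rev_conj_cong)
  finally show ?thesis .
qed

lemma prob_add_Bern_ge:
  fixes X Y :: "'a \<Rightarrow> nat"
  assumes indep: "indep_var (count_space UNIV) X (count_space UNIV) Y"
    and distr_X: "distr M (count_space UNIV) X = measure_pmf (Bern p)"
    and p: "0 \<le> p" "p \<le> 1" and "1 \<le> d"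
  shows "\<P>(\<omega> in M. d \<le> X \<omega> + Y \<omega>)
    = (1 - p) * \<P>(\<omega> in M. d \<le> Y \<omega>) + p * \<P>(\<omega> in M. d - 1 \<le> Y \<omega>)"
proof -
  have [measurable]: "X \<in> measurable M (count_space UNIV)" "Y \<in> measurable M (count_space UNIV)"
    using indep indep_var_rv1 indep_var_rv2 by blast+
  have "(\<lambda>\<omega>. X \<omega> + Y \<omega>) \<in> measurable M (count_space UNIV)"
    by measurable
  from measurable_sets[OF this, of "{d..}"] have [measurable]: "{\<omega> \<in> space M. d \<le> X \<omega> + Y \<omega>} \<in> events"
    by (simp add: vimage_def Int_def conj_commute)
  \<comment> \<open>Only the distribution of \<open>X\<close> is known, so its values are restricted
    to 0 and 1 merely almost everywhere. The case split on \<open>X\<close> below is therefore an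
    equality of events up to a null set.\<close>
  have "AE x in distr M (count_space UNIV) X. x \<in> {0, 1}"
    using p unfolding distr_X Bern_def by (auto simp: AE_measure_pmf_iff of_bool_def)
  then have AE_X: "AE \<omega> in M. X \<omega> \<in> {0, 1}"
    by (subst (asm) AE_distr_iff) auto
  \<comment> \<open>These sets of booleans are the preimages of 1 and 0 under
    \<open>of_bool\<close>.\<close>
  have "{x. x} = {True}" "{x. \<not> x} = {False}"
    by auto
  then have pmf_Bern: "pmf (Bern p) 0 = 1 - p" "pmf (Bern p) 1 = p"
    using p by (simp_all add: Bern_def pmf_map vimage_def measure_pmf_single)
  \<comment> \<open>Events are phrased as membership in a set to fit the product rule
    \<open>prob_indep_random_variable\<close>.\<close>
  have prob_X: "\<P>(\<omega> in M. X \<omega> \<in> {k}) = pmf (Bern p) k" for k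
  proof -
    have "\<P>(\<omega> in M. X \<omega> \<in> {k}) = measure (distr M (count_space UNIV) X) {k}"
      by (subst measure_distr) (auto intro!: arg_cong[where f = prob])
    then show ?thesis by (simp add: distr_X measure_pmf_single)
  qed
  have prob_XY: "\<P>(\<omega> in M. X \<omega> \<in> {k} \<and> Y \<omega> \<in> {e..}) = pmf (Bern p) k * \<P>(\<omega> in M. e \<le> Y \<omega>)"
    for k e
    using prob_indep_random_variable[OF indep, of "{k}" "{e..}"] prob_X[of k] by simp
  have "\<P>(\<omega> in M. d \<le> X \<omega> + Y \<omega>) =
    \<P>(\<omega> in M. (X \<omega> \<in> {0} \<and> Y \<omega> \<in> {d..}) \<or> (X \<omega> \<in> {1} \<and> Y \<omega> \<in> {d - 1..}))"
    using AE_X \<open>1 \<le> d\<close> by (intro finite_measure_eq_AE) auto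
  also have "\<dots> = \<P>(\<omega> in M. X \<omega> \<in> {0} \<and> Y \<omega> \<in> {d..}) + \<P>(\<omega> in M. X \<omega> \<in> {1} \<and> Y \<omega> \<in> {d - 1..})"
    by (subst finite_measure_Union[symmetric]) (auto intro!: arg_cong[where f = prob])
  also have "\<dots> = (1 - p) * \<P>(\<omega> in M. d \<le> Y \<omega>) + p * \<P>(\<omega> in M. d - 1 \<le> Y \<omega>)"
    unfolding prob_XY pmf_Bern ..
  finally show ?thesis .
qed

lemma p_walk_eq_prob:
  fixes U :: "nat \<Rightarrow> 'a \<Rightarrow> nat"
  assumes indep: "indep_vars (\<lambda>_. count_space UNIV) U {2..}"
    and distr_U: "\<And>m. 2 \<le> m \<Longrightarrow>
      distr M (count_space UNIV) (U m) = measure_pmf (Bern (1 / (2 * real m)))"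
    and "1 \<le> n"
  shows "p_walk n d = \<P>(\<omega> in M. d \<le> (\<Sum>m=2..n. U m \<omega>))"
proof -
  define q where "q n d = \<P>(\<omega> in M. d \<le> (\<Sum>m=2..n. U m \<omega>))" for n d
  have "q n d = p_walk n d"
  proof (rule p_walk_unique)
    fix n d :: nat
    assume "2 \<le> n" "1 \<le> d"
    then obtain m where n: "n = Suc m" "1 \<le> m"
      by (cases n) auto
    have "indep_vars (\<lambda>_. count_space UNIV) U (insert n {2..m})"
      by (rule indep_vars_subset[OF indep]) (use n in auto)
    then have "indep_var (count_space UNIV) (U n) (count_space UNIV) (\<lambda>\<omega>. \<Sum>i=2..m. U i \<omega>)"
      by (rule indep_var_sum_count_space[rotated]) (simp add: n)
    from prob_add_Bern_ge[OF this distr_U[OF \<open>2 \<le> n\<close>] _ _ \<open>1 \<le> d\<close>]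
    have "q n d = (1 - 1 / (2 * real n)) * q m d + 1 / (2 * real n) * q m (d - 1)"
      using n by (simp add: q_def add.commute)
    also have "1 - 1 / (2 * real n) = (2 * real n - 1) / (2 * real n)"
      using n by (simp add: field_simps)
    finally show "q n d = (2 * real n - 1) / (2 * real n) * q (n - 1) d
        + 1 / (2 * real n) * q (n - 1) (d - 1)"
      by (simp add: n)
  \<comment> \<open>Boundary values: the threshold 0 is always reached, and for n = 1 the sum is
    empty and never reaches a positive threshold.\<close>
  qed (use \<open>1 \<le> n\<close> in \<open>auto simp: q_def prob_space\<close>)
  then show ?thesis by (simp add: q_def)
qed

end

theorem proposition21:
  shows
    "(\<forall>(M :: 'a measure) (U :: nat \<Rightarrow> 'a \<Rightarrow> nat).
        prob_space M \<longrightarrow>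
        prob_space.indep_vars M (\<lambda>_. count_space UNIV) U {2..} \<longrightarrow>
        (\<forall>m\<ge>2. distr M (count_space UNIV) (U m) = measure_pmf (Bern (1 / (2 * real m)))) \<longrightarrow>
        (\<forall>n\<ge>1. \<forall>d. p_walk n d = \<P>(\<omega> in M. (\<Sum>m=2..n. U m \<omega>) \<ge> d)))
     \<and> (\<forall>n\<ge>2. \<forall>d\<ge>1.
          p_walk n d = (2 * real n - 1) / (2 * real n) * p_walk (n - 1) d
                       + 1 / (2 * real n) * p_walk (n - 1) (d - 1))
     \<and> (\<forall>n\<ge>1. p_walk n 0 = 1)
     \<and> (\<forall>d\<ge>1. p_walk 1 d = 0)
     \<and> (\<forall>q :: nat \<Rightarrow> nat \<Rightarrow> real.
          (\<forall>n\<ge>2. \<forall>d\<ge>1.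
             q n d = (2 * real n - 1) / (2 * real n) * q (n - 1) d
                     + 1 / (2 * real n) * q (n - 1) (d - 1)) \<longrightarrow>
          (\<forall>n\<ge>1. q n 0 = 1) \<longrightarrow>
          (\<forall>d\<ge>1. q 1 d = 0) \<longrightarrow>
          (\<forall>n\<ge>1. \<forall>d. q n d = p_walk n d))"
proof (intro conjI allI impI)
  fix M :: "'a measure" and U :: "nat \<Rightarrow> 'a \<Rightarrow> nat" and n d :: nat
  assume "prob_space M"
    and "prob_space.indep_vars M (\<lambda>_. count_space UNIV) U {2..}"
    and "\<forall>m\<ge>2. distr M (count_space UNIV) (U m) = measure_pmf (Bern (1 / (2 * real m)))"
    and "1 \<le> n"
  then show "p_walk n d = \<P>(\<omega> in M. (\<Sum>m=2..n. U m \<omega>) \<ge> d)"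
    using prob_space.p_walk_eq_prob[of M U n d] by blast
next
  fix q :: "nat \<Rightarrow> nat \<Rightarrow> real" and n d :: nat
  assume "\<forall>n\<ge>2. \<forall>d\<ge>1. q n d = (2 * real n - 1) / (2 * real n) * q (n - 1) d
      + 1 / (2 * real n) * q (n - 1) (d - 1)"
    and "\<forall>n\<ge>1. q n 0 = 1" and "\<forall>d\<ge>1. q 1 d = 0" and "1 \<le> n"
  then show "q n d = p_walk n d"
    by (intro p_walk_unique) blast+
qed (use p_walk_recurrence p_walk_0 p_walk_1 in auto)

end
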